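(* Let $\mathbb K$ be a field with algebraic closure $\overline{\mathbb K}$, let $\mathbf F=(F_1,\dots,F_n)\subset\mathbb K[x_1,\dots,x_n]$, and let $u=\lambda_1x_1+\cdots+\lambda_nx_n$ ($\lambda_i\in\mathbb K$), $q(T)\in\mathbb K[T]$, $\mathbf v(T)=(v_1(T),\dots,v_n(T))\in\mathbb K[T]^n$ satisfy conditions (1)–(5) of the context. Let $\mathbf z_1,\dots,\mathbf z_d\in\overline{\mathbb K}^n$ be the exact roots of $\langle q(T),x_1-v_1(T),\dots,x_n-v_n(T)\rangle\cap\mathbb K[x_1,\dots,x_n]$, and let $$\tilde{\mathbf z}_i:=\mathbf z_i-J_{\mathbf F}(\mathbf z_i)^{-1}\mathbf F(\mathbf z_i),\qquad i=1,\dots,d,$$ be one step of Newton iteration. Assume that $u(\tilde{\mathbf z}_i)\ne u(\tilde{\mathbf z}_j)$ for $i\neq j$. Then the polynomials $\tilde Q(T),\tilde V_1(T),\dots,\tilde V_n(T)$ defined in the context are the exact RUR of $\{\tilde{\mathbf z}_1,\dots,\tilde{\mathbf z}_d\}$, and $\sum_{i=1}^n\lambda_i\tilde V_i(T)=T$.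
   Context: Conditions: (1) $q(T)$ is monic of degree $d$; (2) each $v_i(T)$ has degree at most $d-1$; (3) $\frac{\partial q(T)}{\partial T}$ is invertible modulo $q(T)$; (4) $\lambda_1v_1(T)+\cdots+\lambda_nv_n(T)=T$; (5) $J_{\mathbf F}(\mathbf v(T)):=\left[\frac{\partial F_i}{\partial x_j}(\mathbf v(T))\right]_{i,j=1}^n$ is invertible modulo $q(T)$. Here $J_{\mathbf F}$ is the Jacobian matrix of $\mathbf F$, and "$p \bmod q$" is the remainder of $p$ on division by $q$. Construction: $\mathbf w(T):=\mathbf v(T)-\left(J_{\mathbf F}(\mathbf v(T))^{-1}\mathbf F(\mathbf v(T))\bmod q(T)\right)$; $\Delta(T):=\sum_{i=1}^n\lambda_iw_i(T)-T$; $\tilde V_1,\dots,\tilde V_n$ and $\Delta\tilde Q$ are the polynomials of degree at most $d-1$ determined by $\tilde V_i(T+\Delta(T))\equiv w_i(T)\bmod q(T)$ and $\Delta\tilde Q(T+\Delta(T))\equiv-(T+\Delta(T))^d\bmod q(T)$; $\tilde Q(T):=\Delta\tilde Q(T)+T^d$. Exact RUR (rational univariate representation) of a finite set $\{\tilde{\mathbf z}_1,\dots,\tilde{\mathbf z}_d\}$, $\tilde{\mathbf z}_i=(\tilde z_{i,1},\dots,\tilde z_{i,n})$, with respect to $u$ taking distinct values on the set: the polynomial $\prod_{i=1}^d(T-u(\tilde{\mathbf z}_i))$ together with, for each $j=1,\dots,n$, the unique Lagrange interpolant of degree at most $d-1$ taking the value $\tilde z_{i,j}$ at $u(\tilde{\mathbf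 z}_i)$ for $i=1,\dots,d$. So the claim is that $\tilde Q$ is this product and $\tilde V_j$ are these interpolants. *)

theory Defs
  imports
    "HOL-Algebra.Algebraic_Closure_Type"
    "HOL-Analysis.Cartesian_Space"
    "HOL-Number_Theory.Cong"
    "HOL-Library.Poly_Mapping"
    "HOL-Computational_Algebra.Polynomial"
begin

unbundle no fps_syntax

text \<open>
  Polynomials with coefficients in \<open>'a\<close> in variables indexed by the finite type \<open>'n\<close>:
  finitely supported maps from exponent vectors to coefficients.
\<close>

type_synonym ('n, 'a) mpoly = "('n \<Rightarrow>\<^sub>0 nat) \<Rightarrow>\<^sub>0 'a"

definition mconst :: "'a::comm_ring_1 \<Rightarrow> ('n, 'a) mpoly"
  where "mconst c = Poly_Mapping.single 0 c"

definition mvar :: "'n \<Rightarrow> ('n, 'a::comm_ring_1) mpoly"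
  where "mvar i = Poly_Mapping.single (Poly_Mapping.single i 1) 1"

text \<open>
  Evaluation at a point \<open>x\<close> of an extension ring, into which the coefficients are mapped by
  \<open>h\<close>; below, \<open>h\<close> is the embedding of \<open>K\<close> into \<open>K[T]\<close> or into the algebraic closure of \<open>K\<close>.
\<close>

definition mpeval ::
    "('a::comm_ring_1 \<Rightarrow> 'b::comm_ring_1) \<Rightarrow> ('n::finite, 'a) mpoly \<Rightarrow> 'b ^ 'n \<Rightarrow> 'b"
  where "mpeval h p x =
    (\<Sum>m\<in>Poly_Mapping.keys p.
       h (Poly_Mapping.lookup p m) * (\<Prod>i\<in>UNIV. (x $ i) ^ Poly_Mapping.lookup m i))"

text \<open>
  In the formal partial derivative the truncated subtraction on exponents is harmless, since the
  coefficient vanishes when \<open>i\<close> does not occur in \<open>m\<close>.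
\<close>

definition mpderiv :: "'n \<Rightarrow> ('n, 'a::comm_ring_1) mpoly \<Rightarrow> ('n, 'a) mpoly"
  where "mpderiv i p =
    (\<Sum>m\<in>Poly_Mapping.keys p.
       Poly_Mapping.single (m - Poly_Mapping.single i 1)
         (of_nat (Poly_Mapping.lookup m i) * Poly_Mapping.lookup p m))"

definition eval_system ::
    "('a::comm_ring_1 \<Rightarrow> 'b::comm_ring_1) \<Rightarrow> ('n::finite, 'a) mpoly ^ 'n \<Rightarrow> 'b ^ 'n \<Rightarrow> 'b ^ 'n"
  where "eval_system h F x = (\<chi> i. mpeval h (F $ i) x)"

definition jacobian ::
    "('a::comm_ring_1 \<Rightarrow> 'b::comm_ring_1) \<Rightarrow> ('n::finite, 'a) mpoly ^ 'n \<Rightarrow> 'b ^ 'n \<Rightarrow> 'b ^ 'n ^ 'n"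
  where "jacobian h F x = (\<chi> i j. mpeval h (mpderiv j (F $ i)) x)"

definition const_poly :: "'a::zero \<Rightarrow> 'a poly"
  where "const_poly c = [:c:]"


definition invertible_mod :: "'k::field poly \<Rightarrow> 'k poly \<Rightarrow> bool"
  where "invertible_mod q p \<longleftrightarrow> (\<exists>r. [p * r = 1] (mod q))"

definition inverse_matrix_mod ::
    "'k::field poly \<Rightarrow> 'k poly ^ 'n ^ 'n \<Rightarrow> 'k poly ^ 'n ^ 'n \<Rightarrow> bool"
  where "inverse_matrix_mod q A B \<longleftrightarrow>
    (\<forall>i j. [(A ** B) $ i $ j = mat 1 $ i $ j] (mod q)) \<and>
    (\<forall>i j. [(B ** A) $ i $ j = mat 1 $ i $ j] (mod q))"

definition invertible_matrix_mod :: "'k::field poly \<Rightarrow> 'k poly ^ 'n ^ 'n \<Rightarrow> bool"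
  where "invertible_matrix_mod q A \<longleftrightarrow> (\<exists>B. inverse_matrix_mod q A B)"

text \<open>
  The inverse is unique only up to congruence modulo \<open>q\<close>; it is used below only through
  remainders modulo \<open>q\<close>, which do not depend on the choice.
\<close>

definition matrix_inv_mod :: "'k::field poly \<Rightarrow> 'k poly ^ 'n ^ 'n \<Rightarrow> 'k poly ^ 'n ^ 'n"
  where "matrix_inv_mod q A = (SOME B. inverse_matrix_mod q A B)"


text \<open>
  The ideal \<open>\<langle>q(T), x\<^sub>1 - v\<^sub>1(T), \<dots>, x\<^sub>n - v\<^sub>n(T)\<rangle>\<close> lives in \<open>K[T, x\<^sub>1, \<dots>, x\<^sub>n]\<close>, represented as
  \<open>K[T][x\<^sub>1, \<dots>, x\<^sub>n]\<close>; it is intersected with \<open>K[x\<^sub>1, \<dots>, x\<^sub>n]\<close> by pulling back along the inclusion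
  of coefficients \<open>K \<subseteq> K[T]\<close>.  The span in the module of a commutative ring over itself is the
  generated ideal.
\<close>

definition rur_ideal :: "'k::field poly \<Rightarrow> 'k poly ^ 'n \<Rightarrow> ('n, 'k poly) mpoly set"
  where "rur_ideal q v =
    Modules.module.span (*) (insert (mconst q) (range (\<lambda>i. mvar i - mconst (v $ i))))"

definition rur_elim_ideal :: "'k::field poly \<Rightarrow> 'k poly ^ 'n \<Rightarrow> ('n, 'k) mpoly set"
  where "rur_elim_ideal q v = {p. Poly_Mapping.map const_poly p \<in> rur_ideal q v}"

definition rur_roots :: "'k::field poly \<Rightarrow> 'k poly ^ 'n \<Rightarrow> ('k alg_closure ^ 'n::finite) set"
  where "rur_roots q v = {z. \<forall>p\<in>rur_elim_ideal q v. mpeval to_ac p z = 0}"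


definition newton_step ::
    "('n::finite, 'k::field) mpoly ^ 'n \<Rightarrow> 'k alg_closure ^ 'n \<Rightarrow> 'k alg_closure ^ 'n"
  where "newton_step F z = z - matrix_inv (jacobian to_ac F z) *v eval_system to_ac F z"

definition newton_w ::
    "('n::finite, 'k::field) mpoly ^ 'n \<Rightarrow> 'k poly \<Rightarrow> 'k poly ^ 'n \<Rightarrow> 'k poly ^ 'n"
  where "newton_w F q v =
    (\<chi> i. v $ i -
      (matrix_inv_mod q (jacobian const_poly F v) *v eval_system const_poly F v) $ i mod q)"

definition newton_Delta ::
    "('n::finite, 'k::field) mpoly ^ 'n \<Rightarrow> 'k ^ 'n \<Rightarrow> 'k poly \<Rightarrow> 'k poly ^ 'n \<Rightarrow> 'k poly"
  where "newton_Delta F l q v = (\<Sum>i\<in>UNIV. smult (l $ i) (newton_w F q v $ i)) - [:0, 1:]"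

text \<open>
  The truncated subtraction in the degree bounds is harmless: \<open>\<Sum> l\<^sub>i v\<^sub>i = T\<close> with every \<open>v\<^sub>i\<close> of degree
  at most \<open>degree q - 1\<close> forces \<open>degree q \<ge> 2\<close>.  The descriptions below are meaningful only when the
  polynomial exists and is unique.
\<close>

definition newton_V ::
    "('n::finite, 'k::field) mpoly ^ 'n \<Rightarrow> 'k ^ 'n \<Rightarrow> 'k poly \<Rightarrow> 'k poly ^ 'n \<Rightarrow> 'k poly ^ 'n"
  where "newton_V F l q v =
    (\<chi> i. THE p. degree p \<le> degree q - 1 \<and>
       [pcompose p ([:0, 1:] + newton_Delta F l q v) = newton_w F q v $ i] (mod q))"

definition newton_DeltaQ ::
    "('n::finite, 'k::field) mpoly ^ 'n \<Rightarrow> 'k ^ 'n \<Rightarrow> 'k poly \<Rightarrow> 'k poly ^ 'n \<Rightarrow> 'k poly"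
  where "newton_DeltaQ F l q v =
    (THE p. degree p \<le> degree q - 1 \<and>
       [pcompose p ([:0, 1:] + newton_Delta F l q v)
          = - (([:0, 1:] + newton_Delta F l q v) ^ degree q)] (mod q))"

definition newton_Q ::
    "('n::finite, 'k::field) mpoly ^ 'n \<Rightarrow> 'k ^ 'n \<Rightarrow> 'k poly \<Rightarrow> 'k poly ^ 'n \<Rightarrow> 'k poly"
  where "newton_Q F l q v = newton_DeltaQ F l q v + [:0, 1:] ^ degree q"


definition lin_form :: "'k::field ^ 'n::finite \<Rightarrow> 'k alg_closure ^ 'n \<Rightarrow> 'k alg_closure"
  where "lin_form l z = (\<Sum>i\<in>UNIV. to_ac (l $ i) * z $ i)"

text \<open>
  A polynomial of degree at most \<open>card Z - 1\<close> with prescribed values at the \<open>card Z\<close> distinct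
  nodes \<open>u z\<close> is the Lagrange interpolant.
\<close>

definition exact_rur ::
    "('a::field ^ 'n \<Rightarrow> 'a) \<Rightarrow> ('a ^ 'n) set \<Rightarrow> 'a poly \<Rightarrow> 'a poly ^ 'n \<Rightarrow> bool"
  where "exact_rur u Z Q V \<longleftrightarrow>
    finite Z \<and> inj_on u Z \<and>
    Q = (\<Prod>z\<in>Z. [:- u z, 1:]) \<and>
    (\<forall>j. degree (V $ j) \<le> card Z - 1 \<and> (\<forall>z\<in>Z. poly (V $ j) (u z) = z $ j))"

end

theory Submission
  imports Defs
begin

text \<open>
  If \<open>\<alpha>\<close> runs through the \<open>d\<close> distinct roots of \<open>q\<close>, then the points \<open>v(\<alpha>)\<close> are \<open>d\<close> distinct common
  zeros of the elimination ideal, hence all of the \<open>z\<^sub>i\<close>.  Evaluation at \<open>\<alpha>\<close> is a ring morphism that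
  factors through \<open>K[T]/(q)\<close>, so it turns the modular inverse of the Jacobian into the inverse of its
  value; hence the Newton step maps \<open>v(\<alpha>)\<close> to \<open>w(\<alpha>)\<close>, and \<open>g = T + \<Delta>\<close> satisfies
  \<open>g(\<alpha>) = u(w(\<alpha>))\<close>.  As these \<open>d\<close> values are distinct, \<open>p \<mapsto> p \<circ> g mod q\<close> is injective, thus
  bijective, on the polynomials of degree less than \<open>d\<close>.  The polynomials defining the new RUR
  therefore exist, and their values at the \<open>d\<close> nodes \<open>g(\<alpha>)\<close> determine them.
\<close>

section \<open>Ring morphisms and the evaluation of polynomials\<close>

lemma poly_mapping_eq_sum_single:
  "p = (\<Sum>m\<in>Poly_Mapping.keys p. Poly_Mapping.single m (Poly_Mapping.lookup p m))"
  by (rule poly_mapping_eqI)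
    (auto simp: lookup_sum lookup_single when_def in_keys_iff)

text \<open>The instances needed are the embedding \<open>to_ac\<close> and evaluation of
  \<open>K[T]\<close> at a point of the closure; the latter has a kernel, so only the ring laws are
  assumed.\<close>

locale comm_ring_morphism =
  fixes h :: "'a::comm_ring_1 \<Rightarrow> 'b::comm_ring_1"
  assumes hom_add: "h (a + b) = h a + h b"
    and hom_mult: "h (a * b) = h a * h b"
    and hom_1: "h 1 = 1"
begin

lemma hom_0: "h 0 = 0"
  using hom_add[of 0 0] by simp

lemma hom_minus: "h (- a) = - h a"
  using hom_add[of a "- a"] hom_0 by (simp add: eq_neg_iff_add_eq_0 add.commute)

lemma hom_diff: "h (a - b) = h a - h b"
  using hom_add[of a "- b"] hom_minus by simp

lemma hom_sum: "h (\<Sum>x\<in>S. f x) = (\<Sum>x\<in>S. h (f x))"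
  by (induction S rule: infinite_finite_induct) (auto simp: hom_0 hom_add)

lemma hom_prod: "h (\<Prod>x\<in>S. f x) = (\<Prod>x\<in>S. h (f x))"
  by (induction S rule: infinite_finite_induct) (auto simp: hom_1 hom_mult)

lemma hom_power: "h (a ^ k) = h a ^ k"
  by (induction k) (auto simp: hom_1 hom_mult)

lemma map_poly_hom_add: "map_poly h (p + r) = map_poly h p + map_poly h r"
  by (intro poly_eqI) (simp add: coeff_map_poly hom_0 hom_add)

lemma map_poly_hom_smult: "map_poly h (smult c p) = smult (h c) (map_poly h p)"
  by (intro poly_eqI) (simp add: coeff_map_poly hom_0 hom_mult)

lemma map_poly_hom_mult: "map_poly h (p * r) = map_poly h p * map_poly h r"
  by (intro poly_eqI) (simp add: coeff_map_poly hom_0 coeff_mult hom_sum hom_mult)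

lemma morphism_poly_map_poly: "comm_ring_morphism (\<lambda>p. poly (map_poly h p) a)"
  by unfold_locales (simp_all add: map_poly_hom_add map_poly_hom_mult hom_1)

lemma poly_map_poly_pcompose:
  "poly (map_poly h (pcompose p r)) a = poly (map_poly h p) (poly (map_poly h r) a)"
  by (induction p) (simp_all add: pcompose_pCons map_poly_hom_add map_poly_hom_mult
      map_poly_pCons hom_0)

text \<open>Terms outside the support vanish, so two polynomials can be summed over the union of
  their supports.\<close>

lemma mpeval_superset:
  assumes "finite S" "Poly_Mapping.keys p \<subseteq> S"
  shows "mpeval h p x =
    (\<Sum>m\<in>S. h (Poly_Mapping.lookup p m) * (\<Prod>i\<in>UNIV. (x $ i) ^ Poly_Mapping.lookup m i))"
  unfolding mpeval_def
  by (rule sum.mono_neutral_left) (use assms in \<open>auto simp: hom_0 in_keys_iff\<close>)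

lemma mpeval_single:
  "mpeval h (Poly_Mapping.single m c) x = h c * (\<Prod>i\<in>UNIV. (x $ i) ^ Poly_Mapping.lookup m i)"
  by (subst mpeval_superset[of "{m}"]) auto

lemma mpeval_0: "mpeval h 0 x = 0"
  by (simp add: mpeval_def)

lemma mpeval_add: "mpeval h (p + r) x = mpeval h p x + mpeval h r x"
proof -
  let ?S = "Poly_Mapping.keys p \<union> Poly_Mapping.keys r"
  have "Poly_Mapping.keys (p + r) \<subseteq> ?S"
    by (rule Poly_Mapping.keys_add)
  then show ?thesis
    by (simp add: mpeval_superset[of ?S] lookup_add hom_add distrib_right sum.distrib)
qed

lemma mpeval_sum: "mpeval h (\<Sum>a\<in>S. f a) x = (\<Sum>a\<in>S. mpeval h (f a) x)"
  by (induction S rule: infinite_finite_induct) (auto simp: mpeval_0 mpeval_add)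

lemma mpeval_single_mult:
  "mpeval h (Poly_Mapping.single m c * Poly_Mapping.single k d) x =
     mpeval h (Poly_Mapping.single m c) x * mpeval h (Poly_Mapping.single k d) x"
  by (simp add: mult_single mpeval_single lookup_add power_add prod.distrib hom_mult)

text \<open>By bilinearity it suffices to multiply single terms, where exponents add.\<close>

lemma mpeval_mult:
  fixes p r :: "('n::finite, 'a) mpoly"
  shows "mpeval h (p * r) x = mpeval h p x * mpeval h r x"
proof -
  let ?s = "\<lambda>p m. Poly_Mapping.single m (Poly_Mapping.lookup p m)"
  have "mpeval h (p * r) x =
      mpeval h ((\<Sum>m\<in>Poly_Mapping.keys p. ?s p m) * (\<Sum>m\<in>Poly_Mapping.keys r. ?s r m)) x"
    using poly_mapping_eq_sum_single[of p] poly_mapping_eq_sum_single[of r] by simp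
  also have "\<dots> = mpeval h (\<Sum>m\<in>Poly_Mapping.keys p. ?s p m) x *
      mpeval h (\<Sum>m\<in>Poly_Mapping.keys r. ?s r m) x"
    by (simp add: sum_product mpeval_sum mpeval_single_mult)
  finally show ?thesis
    using poly_mapping_eq_sum_single[of p] poly_mapping_eq_sum_single[of r] by simp
qed

text \<open>With \<open>const_poly\<close> for \<open>f\<close> and evaluation at
  \<open>\<alpha>\<close> for \<open>h\<close>, this carries \<open>F\<close> and its Jacobian along
  \<open>v(T)\<close> to their values at the point \<open>v(\<alpha>)\<close>.\<close>

lemma hom_mpeval: "h (mpeval f p x) = mpeval (\<lambda>c. h (f c)) p (\<chi> i. h (x $ i))"
  by (simp add: mpeval_def hom_sum hom_mult hom_prod hom_power)

end

text \<open>Differentiation multiplies coefficients by natural numbers, which a morphism preserves.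
  This transfers the separability of \<open>q\<close> to the closure.\<close>

lemma map_poly_pderiv:
  fixes h :: "'a::idom \<Rightarrow> 'b::idom"
  assumes "comm_ring_morphism h"
  shows "map_poly h (pderiv p) = pderiv (map_poly h p)"
proof -
  interpret comm_ring_morphism h by fact
  have "h (of_nat k) = of_nat k" for k
    by (induction k) (simp_all add: hom_0 hom_1 hom_add)
  then have "h (1 + of_nat k) = 1 + of_nat k" for k
    by (simp add: hom_add hom_1)
  then show ?thesis
    by (intro poly_eqI) (simp add: coeff_map_poly hom_0 coeff_pderiv hom_mult)
qed

text \<open>The support may shrink where \<open>f\<close> kills a coefficient;
  \<open>g 0 = 0\<close> makes the lost terms vanish.\<close>

lemma mpeval_map:
  assumes "f 0 = 0" "g 0 = 0"
  shows "mpeval g (Poly_Mapping.map f p) x = mpeval (\<lambda>c. g (f c)) p x"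
  unfolding mpeval_def
  by (rule sum.mono_neutral_cong_left)
    (auto simp: Poly_Mapping.map.rep_eq in_keys_iff when_def assms split: if_splits)

text \<open>The polynomials vanishing at this point under \<open>h\<close> form an ideal, and it
  contains all the generators.\<close>

lemma rur_ideal_eval:
  fixes h :: "'k::field poly \<Rightarrow> 'b::comm_ring_1" and v :: "'k poly ^ 'n::finite"
  assumes "comm_ring_morphism h" "h q = 0" "p \<in> rur_ideal q v"
  shows "mpeval h p (\<chi> i. h (v $ i)) = 0"
proof -
  interpret comm_ring_morphism h by fact
  interpret M: Modules.module "(*) :: ('n, 'k poly) mpoly \<Rightarrow> _"
    by unfold_locales (simp_all add: algebra_simps)
  let ?x = "\<chi> i. h (v $ i)"
  have mvar: "mpeval h (mvar i) ?x = h (v $ i)" for i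
  proof -
    have "(\<Prod>j\<in>UNIV. (?x $ j) ^ Poly_Mapping.lookup (Poly_Mapping.single i 1) j) =
        (\<Prod>j\<in>UNIV. if j = i then h (v $ i) else 1)"
      by (intro prod.cong) (auto simp: lookup_single when_def)
    then show ?thesis
      by (simp add: mvar_def mpeval_single hom_1)
  qed
  have mconst: "mpeval h (mconst c) ?x = h c" for c
    by (simp add: mconst_def mpeval_single)
  have "M.span (insert (mconst q) (range (\<lambda>i. mvar i - mconst (v $ i)))) \<subseteq> {p. mpeval h p ?x = 0}"
  proof (rule M.span_minimal)
    have "mpeval h (mvar i - mconst (v $ i)) ?x = 0" for i
      using mpeval_add[of "mvar i - mconst (v $ i)" "mconst (v $ i)" ?x] mvar mconst by simp
    then show "insert (mconst q) (range (\<lambda>i. mvar i - mconst (v $ i))) \<subseteq> {p. mpeval h p ?x = 0}"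
      using mconst assms(2) by auto
    show "M.subspace {p. mpeval h p ?x = 0}"
      by (rule M.subspaceI) (auto simp: mpeval_0 mpeval_add mpeval_mult)
  qed
  then show ?thesis
    using assms(3) by (auto simp: rur_ideal_def)
qed

section \<open>Counting simple roots, and composition modulo a polynomial\<close>

lemma card_roots_eq_degree:
  fixes p :: "'a::alg_closed_field poly"
  assumes "p \<noteq> 0" and simple: "\<And>x. poly p x = 0 \<Longrightarrow> poly (pderiv p) x \<noteq> 0"
  shows "card {x. poly p x = 0} = degree p"
proof -
  obtain A where A: "size A = degree p" "p = smult (lead_coeff p) (\<Prod>x\<in>#A. [:-x, 1:])"
    using alg_closed_imp_factorization[OF assms(1)] by blast
  \<comment> \<open>A repeated linear factor would survive in both summands of the product rule,
    making \<open>x\<close> a common root of \<open>p\<close> and its derivative.\<close>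
  have "count A x = 1" if x: "x \<in># A" for x
  proof (rule ccontr)
    obtain B where B: "A = add_mset x B"
      using x by (metis insert_DiffM)
    assume "count A x \<noteq> 1"
    with B have "x \<in># B" by (auto simp: count_eq_zero_iff)
    then obtain C where "A = add_mset x (add_mset x C)"
      using B by (metis insert_DiffM)
    then have "p = [:-x, 1:] * ([:-x, 1:] * smult (lead_coeff p) (\<Prod>x\<in>#C. [:-x, 1:]))"
      using A(2) by (simp only: image_mset_add_mset prod_mset.add_mset mult_smult_right)
    then obtain r where "p = [:-x, 1:] * ([:-x, 1:] * r)" ..
    then have "poly p x = 0" "poly (pderiv p) x = 0"
      by (simp_all only: pderiv_mult) simp_all
    with simple show False by blast
  qed
  then have "size A = card (set_mset A)"
    by (simp add: size_multiset_overloaded_eq)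
  moreover have "{x. poly p x = 0} = set_mset A"
  proof -
    have "poly p x = 0 \<longleftrightarrow> x \<in># A" for x
      using assms(1) by (subst A(2)) (auto simp: poly_prod_mset image_image)
    then show ?thesis by auto
  qed
  ultimately show ?thesis using A(1) by simp
qed

text \<open>An injective linear map of a finite-dimensional space into itself is bijective; here the
  space consists of the polynomials of degree less than \<open>degree q\<close>, and the map is
  composition with \<open>g\<close> modulo \<open>q\<close>.\<close>

lemma ex1_pcompose_cong:
  fixes q g r :: "'k::field poly"
  assumes deg: "degree q > 0"
    and inj: "\<And>p. degree p < degree q \<Longrightarrow> [pcompose p g = 0] (mod q) \<Longrightarrow> p = 0"
  shows "\<exists>!p. degree p < degree q \<and> [pcompose p g = r] (mod q)"
proof (rule ex_ex1I)
  fix p p' assume "degree p < degree q \<and> [pcompose p g = r] (mod q)"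
    "degree p' < degree q \<and> [pcompose p' g = r] (mod q)"
  then have "degree (p - p') < degree q" "[pcompose (p - p') g = 0] (mod q)"
    by (auto simp: degree_diff_less pcompose_diff cong_def poly_mod_diff_left)
  from inj[OF this] show "p = p'" by simp
next
  interpret V: vector_space "smult :: 'k \<Rightarrow> 'k poly \<Rightarrow> 'k poly"
    by unfold_locales (simp_all add: smult_add_left smult_add_right)
  \<comment> \<open>\<open>b i\<close> is the image of \<open>T ^ i\<close>, and
    \<open>pol c\<close> is the polynomial with coefficients \<open>c\<close>, so that
    \<open>pol_comp\<close> expresses the map in coordinates.\<close>
  define d b where "d = degree q" and "b = (\<lambda>i. g ^ i mod q)"
  define M where "M = (\<lambda>i. monom 1 i :: 'k poly) ` {..<d}"
  define pol where "pol c = (\<Sum>i<d. monom (c i) i)" for c :: "nat \<Rightarrow> 'k"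
  have coeff_pol: "coeff (pol c) i = (if i < d then c i else 0)" for c i
    by (simp add: pol_def coeff_sum)
  have deg_pol: "degree (pol c) < d" for c
    using deg by (intro degree_lessI) (auto simp: coeff_pol d_def)
  have mod_sum: "(\<Sum>i<k. f i) mod q = (\<Sum>i<k. f i mod q)" for f :: "nat \<Rightarrow> 'k poly" and k
    by (induction k) (simp_all add: poly_mod_add_left)
  have pol_comp: "pcompose (pol c) g mod q = (\<Sum>i<d. smult (c i) (b i))" for c
  proof -
    have "pcompose (monom a i) g = smult a (g ^ i)" for a i
      by (induction i) (simp_all add: monom_0 monom_Suc pcompose_pCons)
    then show ?thesis
      by (simp add: pol_def pcompose_sum mod_sum b_def mod_smult_left)
  qed
  have zero: "c i = 0" if "(\<Sum>i<d. smult (c i) (b i)) = 0" "i < d" for c i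
    using inj[of "pol c"] deg_pol[of c] pol_comp[of c] coeff_pol[of c i] that
    by (simp add: cong_def d_def)
  \<comment> \<open>Independence speaks of the set of all \<open>b i\<close>, so repetitions must be
    excluded: \<open>b i = b j\<close> is a linear relation with coefficients \<open>1\<close> and
    \<open>- 1\<close>.\<close>
  have b_inj: "inj_on b {..<d}"
  proof (rule inj_onI, rule ccontr)
    fix i j assume ij: "i \<in> {..<d}" "j \<in> {..<d}" "b i = b j" "i \<noteq> j"
    let ?c = "\<lambda>k. (if k = i then 1 else 0) - (if k = j then 1 else 0 :: 'k)"
    have "(\<Sum>k<d. smult (?c k) (b k)) =
        (\<Sum>k<d. (if k = i then b k else 0) - (if k = j then b k else 0))"
      by (intro sum.cong) auto
    also have "\<dots> = 0"
      using ij by (simp add: sum_subtractf)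
    finally have "?c i = 0" by (rule zero) (use ij in auto)
    with ij show False by simp
  qed
  have indep: "V.independent (b ` {..<d})"
  proof (rule V.independent_if_scalars_zero)
    fix f x assume "(\<Sum>x\<in>b ` {..<d}. smult (f x) x) = 0" "x \<in> b ` {..<d}"
    then show "f x = 0"
      using zero[of "\<lambda>i. f (b i)"] b_inj by (auto simp: sum.reindex)
  qed simp
  have in_span: "p \<in> V.span M" if "degree p < d" for p
  proof -
    have "p = (\<Sum>i<d. smult (coeff p i) (monom 1 i))"
      using that by (intro poly_eqI) (auto simp: coeff_sum coeff_eq_0 if_distrib cong: if_cong)
    also have "\<dots> \<in> V.span M"
      by (intro V.span_sum V.span_scale V.span_base) (auto simp: M_def)
    finally show ?thesis .
  qed
  have deg_mod: "degree (p mod q) < d" for p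
    using deg degree_mod_less[of q p] by (cases "q = 0") (auto simp: d_def)
  have "r mod q \<in> V.span (b ` {..<d})"
  \<comment> \<open>Otherwise \<open>r mod q\<close> and the \<open>b i\<close> would be
    \<open>d + 1\<close> independent vectors in the span of the \<open>d\<close> monomials of degree
    below \<open>d\<close>.\<close>
  proof (rule ccontr)
    assume r: "r mod q \<notin> V.span (b ` {..<d})"
    then have not_in: "r mod q \<notin> b ` {..<d}"
      by (rule contrapos_nn) (rule V.span_base)
    have "V.independent (insert (r mod q) (b ` {..<d}))"
      using V.independent_insertI[OF r indep] .
    moreover have "insert (r mod q) (b ` {..<d}) \<subseteq> V.span M"
      by (auto simp: b_def intro!: in_span deg_mod)
    ultimately have "card (insert (r mod q) (b ` {..<d})) \<le> card M"
      using V.independent_span_bound[of M] by (auto simp: M_def)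
    also have "card M \<le> d"
      unfolding M_def using card_image_le[of "{..<d}"] by auto
    finally show False
      using card_image[OF b_inj] not_in by simp
  qed
  then obtain u where "r mod q = (\<Sum>x\<in>b ` {..<d}. smult (u x) x)"
    by (auto simp: V.span_finite)
  also have "\<dots> = pcompose (pol (\<lambda>i. u (b i))) g mod q"
    by (simp add: pol_comp sum.reindex[OF b_inj])
  finally show "\<exists>p. degree p < degree q \<and> [pcompose p g = r] (mod q)"
    using deg_pol by (auto simp: cong_def d_def intro!: exI[of _ "pol (\<lambda>i. u (b i))"])
qed

section \<open>Values at a root of \<open>q\<close>\<close>

lemma morphism_eval_to_ac: "comm_ring_morphism (\<lambda>p. poly (map_poly to_ac p) a)"
  by (rule comm_ring_morphism.morphism_poly_map_poly) (unfold_locales, simp_all)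

text \<open>The difference \<open>p - r\<close> is a multiple of \<open>q\<close>, which vanishes at
  \<open>a\<close>.\<close>

lemma eval_to_ac_cong:
  assumes "poly (map_poly to_ac q) a = 0" "[p = r] (mod q)"
  shows "poly (map_poly to_ac p) a = poly (map_poly to_ac r) a"
proof -
  interpret comm_ring_morphism "\<lambda>p. poly (map_poly to_ac p) a"
    by (rule morphism_eval_to_ac)
  obtain s where "p - r = q * s"
    using assms(2) by (auto simp: cong_iff_dvd_diff)
  then have "p = r + q * s"
    by (simp add: algebra_simps)
  then show ?thesis
    using assms(1) hom_add[of r "q * s"] hom_mult[of q s] by simp
qed

lemma newton_step_eval:
  fixes F :: "('n::finite, 'k::field) mpoly ^ 'n" and v :: "'k poly ^ 'n"
  assumes root: "poly (map_poly to_ac q) a = 0"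
    and jac: "invertible_matrix_mod q (jacobian const_poly F v)"
  shows "newton_step F (\<chi> i. poly (map_poly to_ac (v $ i)) a) =
    (\<chi> i. poly (map_poly to_ac (newton_w F q v $ i)) a)"
proof -
  define ev where "ev = (\<lambda>p. poly (map_poly to_ac p) a)"
  interpret comm_ring_morphism ev
    unfolding ev_def by (rule morphism_eval_to_ac)
  have ev_cong: "ev p = ev r" if "[p = r] (mod q)" for p r
    unfolding ev_def by (rule eval_to_ac_cong[OF root that])
  have ev_const: "ev (const_poly c) = to_ac c" for c
    by (simp add: ev_def const_poly_def map_poly_pCons)
  define pt where "pt = (\<chi> i. ev (v $ i))"
  define M where "M U = (\<chi> i j. ev (U $ i $ j))" for U :: "'k poly ^ 'n ^ 'n"
  define J where "J = jacobian const_poly F v"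
  define B where "B = matrix_inv_mod q J"
  have M_mult: "M (U ** W) = M U ** M W" for U W
    by (simp add: M_def matrix_matrix_mult_def vec_eq_iff hom_sum hom_mult)
  have M_1: "M (mat 1) = mat 1"
    by (simp add: M_def mat_def vec_eq_iff hom_1 hom_0)
  have M_cong: "M U = M W" if "\<forall>i j. [U $ i $ j = W $ i $ j] (mod q)" for U W :: "'k poly ^ 'n ^ 'n"
    using that by (auto simp: M_def vec_eq_iff intro: ev_cong)
  have "inverse_matrix_mod q J B"
    using jac unfolding B_def matrix_inv_mod_def J_def invertible_matrix_mod_def
    by (rule someI_ex)
  then have "M (J ** B) = M (mat 1)" "M (B ** J) = M (mat 1)"
    unfolding inverse_matrix_mod_def by (blast intro: M_cong)+
  then have JB: "M J ** M B = mat 1" "M B ** M J = mat 1"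
    by (simp_all add: M_mult M_1)
  \<comment> \<open>\<open>matrix_inv\<close> is a choice, meaningful once a two-sided inverse
    exists; uniqueness of inverses then identifies it with \<open>M B\<close>.\<close>
  have "M J ** matrix_inv (M J) = mat 1 \<and> matrix_inv (M J) ** M J = mat 1"
    unfolding matrix_inv_def by (rule someI_ex) (use JB in blast)
  then have inv: "matrix_inv (M J) = M B"
    using JB by (metis matrix_mul_assoc matrix_mul_lid matrix_mul_rid)
  have MJ: "M J = jacobian to_ac F pt"
    by (simp add: M_def J_def jacobian_def vec_eq_iff hom_mpeval ev_const pt_def)
  have sys: "ev (eval_system const_poly F v $ i) = eval_system to_ac F pt $ i" for i
    by (simp add: eval_system_def hom_mpeval ev_const pt_def)
  have "ev (newton_w F q v $ i) = pt $ i - (M B *v eval_system to_ac F pt) $ i" for i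
  proof -
    have "ev (newton_w F q v $ i) = pt $ i - ev ((B *v eval_system const_poly F v) $ i mod q)"
      by (simp add: newton_w_def hom_diff pt_def B_def J_def)
    \<comment> \<open>The reduction modulo \<open>q\<close> in the construction of \<open>w\<close>
      is invisible at a root of \<open>q\<close>.\<close>
    also have "ev ((B *v eval_system const_poly F v) $ i mod q) =
        ev ((B *v eval_system const_poly F v) $ i)"
      by (rule ev_cong) (simp add: cong_def)
    also have "\<dots> = (M B *v eval_system to_ac F pt) $ i"
      by (simp add: matrix_vector_mult_def hom_sum hom_mult sys M_def)
    finally show ?thesis .
  qed
  then have "newton_step F pt = (\<chi> i. ev (newton_w F q v $ i))"
    by (simp add: newton_step_def vec_eq_iff inv flip: MJ)
  then show ?thesis
    by (simp add: pt_def ev_def)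
qed

theorem proposition9:
  fixes F :: "('n::finite, 'k::field) mpoly ^ 'n"
    and l :: "'k ^ 'n"
    and q :: "'k poly"
    and v :: "'k poly ^ 'n"
    and d :: nat
    and z :: "nat \<Rightarrow> 'k alg_closure ^ 'n"
  assumes q_monic: "lead_coeff q = 1" and q_degree: "degree q = d"
    and v_degree: "\<And>i. degree (v $ i) \<le> d - 1"
    and q_sep: "invertible_mod q (pderiv q)"
    and l_v: "(\<Sum>i\<in>UNIV. smult (l $ i) (v $ i)) = [:0, 1:]"
    and jac: "invertible_matrix_mod q (jacobian const_poly F v)"
    and roots: "bij_betw z {1..d} (rur_roots q v)"
    and distinct_u: "\<And>i j. i \<in> {1..d} \<Longrightarrow> j \<in> {1..d} \<Longrightarrow> i \<noteq> j \<Longrightarrow>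
           lin_form l (newton_step F (z i)) \<noteq> lin_form l (newton_step F (z j))"
  shows "exact_rur (lin_form l) ((\<lambda>i. newton_step F (z i)) ` {1..d})
           (map_poly to_ac (newton_Q F l q v))
           (\<chi> j. map_poly to_ac (newton_V F l q v $ j))
         \<and> (\<Sum>i\<in>UNIV. smult (l $ i) (newton_V F l q v $ i)) = [:0, 1:]"
proof -
  define ev where "ev a p = poly (map_poly to_ac p) a" for a and p :: "'k poly"
  have ev_hom: "comm_ring_morphism (ev a)" for a
    unfolding ev_def by (rule morphism_eval_to_ac)
  have ac_hom: "comm_ring_morphism (to_ac :: 'k \<Rightarrow> _)"
    by unfold_locales simp_all
  note ev_sum = comm_ring_morphism.hom_sum[OF ev_hom]
    and ev_mult = comm_ring_morphism.hom_mult[OF ev_hom]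
    and ev_1 = comm_ring_morphism.hom_1[OF ev_hom]
    and ev_minus = comm_ring_morphism.hom_minus[OF ev_hom]
    and ev_power = comm_ring_morphism.hom_power[OF ev_hom]
  have ev_smult: "ev a (smult c p) = to_ac c * ev a p" for a c p
    unfolding ev_def by (simp add: comm_ring_morphism.map_poly_hom_smult[OF ac_hom])
  have ev_X: "ev a [:0, 1:] = a" for a
    by (simp add: ev_def map_poly_pCons)
  have ev_pcompose: "ev a (pcompose p r) = poly (map_poly to_ac p) (ev a r)" for a p r
    unfolding ev_def by (rule comm_ring_morphism.poly_map_poly_pcompose[OF ac_hom])
  have degree_ac: "degree (map_poly to_ac p) = degree p" for p :: "'k poly"
    by (rule degree_map_poly) simp

  \<comment> \<open>The sum is \<open>T\<close>, of degree 1, so \<open>1 \<le> d - 1\<close>. Hence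
    \<open>q\<close> is not constant, and a bound by \<open>d - 1\<close> means degree less than
    \<open>d\<close>.\<close>
  have "degree (\<Sum>i\<in>UNIV. smult (l $ i) (v $ i)) \<le> d - 1"
    by (intro degree_sum_le order.trans[OF degree_smult_le v_degree]) auto
  then have d2: "d \<ge> 2"
    by (simp add: l_v)

  \<comment> \<open>The roots of \<open>q\<close> and the points they parametrize\<close>
  define A where "A = {a. ev a q = 0}"
  define pt where "pt a = (\<chi> i. ev a (v $ i))" for a
  have ev_cong: "ev a p = ev a r" if "a \<in> A" "[p = r] (mod q)" for a p r
    using eval_to_ac_cong[OF _ that(2)] that(1) by (simp add: A_def ev_def)

  have card_A: "card A = d"
  proof -
    obtain r where r: "[pderiv q * r = 1] (mod q)"
      using q_sep by (auto simp: invertible_mod_def)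
    \<comment> \<open>At a root of \<open>q\<close> the congruence says that the derivative times
      \<open>r\<close> has value 1, so the root is simple.\<close>
    have "ev a (pderiv q) \<noteq> 0" if "a \<in> A" for a
      using ev_cong[OF that r] by (auto simp: ev_mult ev_1)
    then have "card {a. poly (map_poly to_ac q) a = 0} = degree (map_poly to_ac q)"
      using d2 q_degree
      by (intro card_roots_eq_degree)
        (auto simp: A_def ev_def map_poly_pderiv[OF ac_hom] map_poly_eq_0_iff)
    then show ?thesis
      by (simp add: A_def ev_def degree_ac q_degree)
  qed
  then have fin_A: "finite A"
    using d2 by (auto intro: card_ge_0_finite)

  \<comment> \<open>The linear form recovers the parameter, so \<open>pt\<close> is
    injective.\<close>
  have lin_pt: "lin_form l (pt a) = a" for a
    using arg_cong[OF l_v, of "ev a"] by (simp add: lin_form_def pt_def ev_sum ev_smult ev_X)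
  \<comment> \<open>One inclusion is checked directly; equality follows by counting, since the
    bijection \<open>z\<close> gives the right-hand points \<open>d\<close> preimages and
    \<open>rur_roots q v\<close> also has \<open>d\<close> elements.\<close>
  have roots_eq: "rur_roots q v = pt ` A"
  proof (rule card_subset_eq[symmetric])
    show "finite (rur_roots q v)"
      using roots by (simp add: bij_betw_finite[symmetric])
    have "mpeval to_ac p (pt a) = 0" if "a \<in> A" "p \<in> rur_elim_ideal q v" for a p
    proof -
      have "mpeval (ev a) (Poly_Mapping.map const_poly p) (pt a) = 0"
        unfolding pt_def using that
        by (intro rur_ideal_eval[OF ev_hom]) (auto simp: A_def rur_elim_ideal_def)
      also have "mpeval (ev a) (Poly_Mapping.map const_poly p) (pt a) = mpeval to_ac p (pt a)"
        by (subst mpeval_map) (simp_all add: ev_def const_poly_def map_poly_pCons)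
      finally show ?thesis .
    qed
    then show "pt ` A \<subseteq> rur_roots q v"
      by (auto simp: rur_roots_def)
    have "inj_on pt A"
      by (rule inj_on_inverseI[of _ "lin_form l"]) (rule lin_pt)
    then show "card (pt ` A) = card (rur_roots q v)"
      using bij_betw_same_card[OF roots] by (simp add: card_image card_A)
  qed

  \<comment> \<open>The Newton step along the parametrization and the new nodes\<close>
  define w where "w = newton_w F q v"
  define g where "g = [:0, 1:] + newton_Delta F l q v"
  define node where "node a = ev a g" for a
  have step: "newton_step F (pt a) = (\<chi> i. ev a (w $ i))" if "a \<in> A" for a
    unfolding pt_def ev_def w_def
    by (rule newton_step_eval[OF _ jac]) (use that in \<open>simp add: A_def ev_def\<close>)
  \<comment> \<open>The two occurrences of \<open>T\<close> cancel, so \<open>g\<close> is the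
    linear form applied to \<open>w\<close>.\<close>
  have g_sum: "g = (\<Sum>i\<in>UNIV. smult (l $ i) (w $ i))"
    by (simp add: g_def newton_Delta_def w_def)
  have node: "node a = lin_form l (newton_step F (pt a))" if "a \<in> A" for a
    by (simp add: node_def step[OF that] g_sum lin_form_def ev_sum ev_smult)
  have node_inj: "inj_on node A"
  proof (rule inj_onI)
    fix a b assume ab: "a \<in> A" "b \<in> A" "node a = node b"
    have "z ` {1..d} = pt ` A"
      using roots roots_eq by (simp add: bij_betw_def)
    then obtain i j where "i \<in> {1..d}" "pt a = z i" "j \<in> {1..d}" "pt b = z j"
      using ab(1,2) by (metis image_iff)
    then have "pt a = pt b"
      using distinct_u[of i j] ab by (metis node)
    then show "a = b"
      by (metis lin_pt)
  qed
  then have card_nodes: "card (node ` A) = d"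
    by (simp add: card_image card_A)

  \<comment> \<open>The polynomials determined by congruences\<close>
  have pcompose_inj: "p = 0" if "degree p < degree q" "[pcompose p g = 0] (mod q)" for p
  proof -
    \<comment> \<open>Over the closure, \<open>p\<close> vanishes at the \<open>d\<close> distinct
      nodes \<open>g(\<alpha>)\<close>, while its degree is less than \<open>d\<close>.\<close>
    have "map_poly to_ac p = 0"
    proof (rule poly_eqI_degree)
      fix x assume "x \<in> node ` A"
      then show "poly (map_poly to_ac p) x = poly 0 x"
        using ev_cong[OF _ that(2)] by (auto simp: ev_pcompose node_def) (simp add: ev_def)
    qed (use that(1) q_degree card_nodes degree_ac in auto)
    then show ?thesis by (simp add: map_poly_eq_0_iff)
  qed
  \<comment> \<open>This justifies the definite descriptions in \<open>newton_V\<close> and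
    \<open>newton_DeltaQ\<close>.\<close>
  have ex1: "\<exists>!p. degree p \<le> degree q - 1 \<and> [pcompose p g = r] (mod q)" for r
  proof -
    have "degree p \<le> degree q - 1 \<longleftrightarrow> degree p < degree q" for p :: "'k poly"
      using d2 q_degree by linarith
    then show ?thesis
      using ex1_pcompose_cong[of q g r] pcompose_inj d2 q_degree by simp
  qed

  define V where "V = newton_V F l q v"
  define D where "D = newton_DeltaQ F l q v"
  have V: "degree (V $ i) \<le> d - 1" "[pcompose (V $ i) g = w $ i] (mod q)" for i
    using theI'[OF ex1[of "w $ i"]] by (simp_all add: V_def newton_V_def g_def w_def q_degree)
  have D: "degree D \<le> d - 1" "[pcompose D g = - (g ^ d)] (mod q)"
    using theI'[OF ex1[of "- (g ^ d)"]]
    by (simp_all add: D_def newton_DeltaQ_def g_def q_degree)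
  have V_node: "poly (map_poly to_ac (V $ i)) (node a) = newton_step F (pt a) $ i" if "a \<in> A" for a i
    using ev_cong[OF that V(2)[of i]] by (simp add: ev_pcompose node_def step[OF that])
  have D_node: "poly (map_poly to_ac D) (node a) = - (node a ^ d)" if "a \<in> A" for a
    using ev_cong[OF that D(2)] by (simp add: ev_pcompose node_def ev_minus ev_power)

  \<comment> \<open>The Newton iterates and the new representation\<close>
  define Z where "Z = (\<lambda>i. newton_step F (z i)) ` {1..d}"
  have Z: "Z = (\<lambda>a. newton_step F (pt a)) ` A"
    using roots roots_eq by (metis Z_def bij_betw_def image_image)
  have Z_nodes: "lin_form l ` Z = node ` A"
    unfolding Z image_image by (rule image_cong) (simp_all add: node)
  have fin_Z: "finite Z"
    by (simp add: Z_def)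
  \<comment> \<open>The cardinality is squeezed: the image of \<open>Z\<close> under the linear form
    has \<open>d\<close> elements, and \<open>Z\<close> is itself an image of
    \<open>A\<close>.\<close>
  have card_Z: "card Z = d"
    using card_image_le[OF fin_Z, of "lin_form l"] card_image_le[OF fin_A, of "\<lambda>a. newton_step F (pt a)"]
    by (simp add: Z_nodes card_nodes card_A flip: Z)
  have inj_Z: "inj_on (lin_form l) Z"
    by (rule eq_card_imp_inj_on[OF fin_Z]) (simp add: Z_nodes card_nodes card_Z)

  have Q: "map_poly to_ac (newton_Q F l q v) = (\<Prod>y\<in>Z. [:- lin_form l y, 1:])"
  \<comment> \<open>Both sides are monic of degree \<open>d\<close> and vanish at the
    \<open>d\<close> nodes; on the left, the value of \<open>D\<close> at a node cancels the term
    \<open>T ^ d\<close>.\<close>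
  proof (rule poly_eqI_degree_lead_coeff)
    let ?P = "\<Prod>y\<in>Z. [:- lin_form l y, 1:]"
    have Q_def: "newton_Q F l q v = D + monom 1 d"
      by (simp add: newton_Q_def D_def q_degree monom_altdef)
    have degP: "degree ?P = d"
      by (simp add: degree_prod_sum_eq card_Z)
    have "lead_coeff ?P = 1"
      by (simp add: lead_coeff_prod)
    then show "coeff (map_poly to_ac (newton_Q F l q v)) d = coeff ?P d"
      using D(1) d2 degP by (simp add: Q_def coeff_map_poly coeff_eq_0)
    show "d \<le> card (node ` A)"
      by (simp add: card_nodes)
    show "degree (map_poly to_ac (newton_Q F l q v)) \<le> d"
      using D(1) by (auto simp: degree_ac Q_def degree_monom_eq intro: degree_add_le)
    show "degree ?P \<le> d"
      by (simp add: degP)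
    fix x assume "x \<in> node ` A"
    then obtain a where a: "a \<in> A" "x = node a" by blast
    have "poly ?P x = 0"
      using \<open>x \<in> node ` A\<close> fin_Z by (auto simp: poly_prod simp flip: Z_nodes)
    moreover have "poly (map_poly to_ac (newton_Q F l q v)) x = 0"
      using D_node[OF a(1)] comm_ring_morphism.map_poly_hom_add[OF ac_hom]
      by (simp add: Q_def a(2) map_poly_monom poly_monom)
    ultimately show "poly (map_poly to_ac (newton_Q F l q v)) x = poly ?P x" by simp
  qed

  have "map_poly to_ac (\<Sum>i\<in>UNIV. smult (l $ i) (V $ i)) = map_poly to_ac [:0, 1:]"
  \<comment> \<open>Both sides have degree less than \<open>d\<close> and agree at the
    \<open>d\<close> nodes: there the \<open>V $ i\<close> take the coordinates of an iterate, whose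
    linear form is the node.\<close>
  proof (rule poly_eqI_degree)
    fix x assume "x \<in> node ` A"
    then obtain a where a: "a \<in> A" "x = node a" by blast
    have "ev x (\<Sum>i\<in>UNIV. smult (l $ i) (V $ i)) = lin_form l (newton_step F (pt a))"
      using V_node[OF a(1)] by (simp add: ev_sum ev_smult lin_form_def) (simp add: ev_def a(2))
    then show "poly (map_poly to_ac (\<Sum>i\<in>UNIV. smult (l $ i) (V $ i))) x =
        poly (map_poly to_ac [:0, 1:]) x"
      using ev_X[of x] by (simp add: ev_def a node)
  next
    have "degree (\<Sum>i\<in>UNIV. smult (l $ i) (V $ i)) \<le> d - 1"
      by (intro degree_sum_le order.trans[OF degree_smult_le V(1)]) auto
    then show "degree (map_poly to_ac (\<Sum>i\<in>UNIV. smult (l $ i) (V $ i))) < card (node ` A)"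
      using d2 by (simp add: degree_ac card_nodes)
    show "degree (map_poly to_ac [:0, 1 :: 'k:]) < card (node ` A)"
      using d2 by (simp add: degree_ac card_nodes)
  qed
  \<comment> \<open>Injectivity of \<open>to_ac\<close> brings the identity back to
    \<open>K[T]\<close>.\<close>
  then have "(\<Sum>i\<in>UNIV. smult (l $ i) (V $ i)) = [:0, 1:]"
    by (metis (no_types, lifting) coeff_map_poly poly_eqI to_ac_0 to_ac_eq_iff)
  moreover have "poly (map_poly to_ac (V $ j)) (lin_form l y) = y $ j" if "y \<in> Z" for y j
    using that V_node node by (auto simp: Z)
  then have "exact_rur (lin_form l) Z (map_poly to_ac (newton_Q F l q v))
      (\<chi> j. map_poly to_ac (V $ j))"
    unfolding exact_rur_def using fin_Z inj_Z Q V(1)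
    by (simp add: card_Z degree_ac)
  ultimately show ?thesis
    by (simp add: V_def Z_def)
qed

end
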